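(* Consider the discrete one-side order book model with Poisson arrival at rate $\mu>0$ of unit-size market orders, Poisson arrival of limit orders with rate $\lambda_i$ at price $i\in\{1,\dots,K\}$ and random sizes with distribution $(g^i_n)_{n\ge1}$ on $\{1,2,\dots\}$ having finite mean $\overline{g^i}=\sum_{n\ge1}n g^i_n$, and exponential lifetimes, with parameter $\theta>0$, of non-executed shares of limit orders. Fix $k\in\{1,\dots,K\}$ with $\lambda_{1\to k}=\sum_{i=1}^k\lambda_i>0$, and set $$\delta=\frac{\mu}{\theta},\quad \nu_{1\to k}=\frac{\lambda_{1\to k}}{\theta},\quad g^{1\to k}_n=\sum_{i=1}^k\frac{\lambda_i}{\lambda_{1\to k}}g^i_n,\quad \overline{g^{1\to k}}=\sum_{i=1}^k\frac{\lambda_i}{\lambda_{1\to k}}\overline{g^i},$$ $$G^{1\to k}(z)=\sum_{n\ge1}g^{1\to k}_n z^n,\qquad H^{1\to k}(z)=\frac{1-G^{1\to k}(z)}{1-z}.$$ Then the average cumulative shape of the order book up to price $k$, i.e. the expectation of $L^{1\to k}$ under its stationary distribution, is $$\mathbf E[L^{1\to k}]=\nu_{1\to k}\,\overline{g^{1\to k}}-\delta+\left(\int_0^1 v^{\delta-1}e^{\nu_{1\to k}\int_v^1 H^{1\to k}(u)\,du}\,dv\right)^{-1}.$$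
   Context: One-side order book model: all limit orders are sell (ask) orders and all market orders are buy orders; prices lie in $\{1,\dots,K\}$ (in ticks). Limit orders at price $i$ arrive according to a Poisson process of rate $\lambda_i\ge0$, independently across prices. The sizes (numbers of shares) of limit orders are independent random variables, and a limit order at price $i$ has size $n$ with probability $g^i_n$, $n\ge1$. Market orders have unit size and arrive according to an independent Poisson process of rate $\mu$; each market order removes one standing share at the lowest available price, if any. Cancellation is share by share: each standing share not yet executed is cancelled after an independent exponential time of parameter $\theta$ from its submission. $L^{1\to k}(t)$ is the total number of shares offered at prices $1,\dots,k$ in the book at time $t$. It is a continuous-time Markov chain on $\{0,1,2,\dots\}$ (the size of an $M^X/M/1+M$ queue) with transition rates: $m\to m+n$ at rate $\lambda_{1\to k}g^{1\to k}_n$ for $m\ge0$, $n\ge1$; and $m\to m-1$ at rate $\mu+m\theta$ for $m\ge1$; no other transitions. *)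

theory Defs
  imports "HOL-Probability.Probability"
begin

text \<open>
  A continuous-time Markov chain on a discrete state space is given by its transition function:
  \<open>P t x\<close> is the law at time \<open>t\<close> of the chain started in \<open>x\<close> (values for \<open>t < 0\<close> are irrelevant).
  It has transition rates \<open>q\<close> if, as \<open>t\<close> decreases to \<open>0\<close>, the probability of being in \<open>y \<noteq> x\<close> is
  \<open>q x y * t + o(t)\<close> and that of being in \<open>x\<close> is \<open>1 - c * t + o(t)\<close>, where the exit rate \<open>c\<close> is the
  (finite) sum of the rates out of \<open>x\<close>; diagonal values of \<open>q\<close> are not used.
\<close>

definition markov_transition_function :: "(real \<Rightarrow> 'a \<Rightarrow> 'a pmf) \<Rightarrow> bool" where
  "markov_transition_function P \<longleftrightarrow>
     (\<forall>x. P 0 x = return_pmf x) \<and>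
     (\<forall>s\<ge>0. \<forall>t\<ge>0. \<forall>x. P (s + t) x = bind_pmf (P s x) (P t))"

definition has_transition_rates :: "(real \<Rightarrow> 'a \<Rightarrow> 'a pmf) \<Rightarrow> ('a \<Rightarrow> 'a \<Rightarrow> real) \<Rightarrow> bool" where
  "has_transition_rates P q \<longleftrightarrow>
     (\<forall>x y. x \<noteq> y \<longrightarrow> ((\<lambda>t. pmf (P t x) y) has_real_derivative q x y) (at_right 0)) \<and>
     (\<forall>x. \<exists>c. (q x has_sum c) (- {x}) \<and>
              ((\<lambda>t. pmf (P t x) x) has_real_derivative - c) (at_right 0))"

definition markov_chain_with_rates :: "(real \<Rightarrow> 'a \<Rightarrow> 'a pmf) \<Rightarrow> ('a \<Rightarrow> 'a \<Rightarrow> real) \<Rightarrow> bool" where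
  "markov_chain_with_rates P q \<longleftrightarrow> markov_transition_function P \<and> has_transition_rates P q"

definition stationary_distribution :: "(real \<Rightarrow> 'a \<Rightarrow> 'a pmf) \<Rightarrow> 'a pmf \<Rightarrow> bool" where
  "stationary_distribution P \<pi> \<longleftrightarrow> (\<forall>t\<ge>0. bind_pmf \<pi> (P t) = \<pi>)"

text \<open>
  Below, \<open>lam i\<close> is the arrival rate and \<open>g i\<close> the size distribution of limit orders at price \<open>i\<close>.
  Sizes are at least 1, so the terms with index 0 in the series over \<open>n\<close> vanish.
\<close>

definition cum_rate :: "(nat \<Rightarrow> real) \<Rightarrow> nat \<Rightarrow> real" where
  "cum_rate lam k = (\<Sum>i=1..k. lam i)"

definition cum_size_prob :: "(nat \<Rightarrow> real) \<Rightarrow> (nat \<Rightarrow> nat pmf) \<Rightarrow> nat \<Rightarrow> nat \<Rightarrow> real" where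
  "cum_size_prob lam g k n = (\<Sum>i=1..k. lam i / cum_rate lam k * pmf (g i) n)"

definition mean_size :: "nat pmf \<Rightarrow> real" where
  "mean_size p = (\<Sum>n. real n * pmf p n)"

definition cum_mean_size :: "(nat \<Rightarrow> real) \<Rightarrow> (nat \<Rightarrow> nat pmf) \<Rightarrow> nat \<Rightarrow> real" where
  "cum_mean_size lam g k = (\<Sum>i=1..k. lam i / cum_rate lam k * mean_size (g i))"

definition cum_size_gf :: "(nat \<Rightarrow> real) \<Rightarrow> (nat \<Rightarrow> nat pmf) \<Rightarrow> nat \<Rightarrow> real \<Rightarrow> real" where
  "cum_size_gf lam g k z = (\<Sum>n. cum_size_prob lam g k n * z ^ n)"

definition cum_size_H :: "(nat \<Rightarrow> real) \<Rightarrow> (nat \<Rightarrow> nat pmf) \<Rightarrow> nat \<Rightarrow> real \<Rightarrow> real" where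
  "cum_size_H lam g k z = (1 - cum_size_gf lam g k z) / (1 - z)"

text \<open>Transition rates of the number of shares standing at prices \<open>1, \<dots>, k\<close>.\<close>

definition book_rates ::
  "real \<Rightarrow> real \<Rightarrow> (nat \<Rightarrow> real) \<Rightarrow> (nat \<Rightarrow> nat pmf) \<Rightarrow> nat \<Rightarrow> nat \<Rightarrow> nat \<Rightarrow> real" where
  "book_rates \<mu> \<theta> lam g k m m' =
     (if m < m' then cum_rate lam k * cum_size_prob lam g k (m' - m)
      else if m = Suc m' then \<mu> + real m * \<theta>
      else 0)"

end

theory Submission
  imports Defs
begin

text \<open>
  For a stationary law, keeping finitely many terms of \<open>\<pi> = \<pi> P\<^sub>t\<close> and letting \<open>t\<close> decrease to \<open>0\<close> shows
  that the flow into each state is at most the flow out of it. Since downward jumps have size 1,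
  this says that the net upward flow across the cut above \<open>n\<close> is nonnegative and nondecreasing in
  \<open>n\<close>. The upward flows are summable, with sum \<open>\<lambda>\<close> times the mean size, so the net flows vanish. The
  resulting recursion determines \<open>\<pi>\<close>, and summing it gives the mean in terms of \<open>\<pi>\<^sub>0\<close>:
  \<open>E = \<nu> m - \<delta> (1 - \<pi>\<^sub>0)\<close>. For the generating function the recursion is a first-order linear equation,
  whose solution with value \<open>1\<close> at \<open>1\<close> gives \<open>\<delta> \<pi>\<^sub>0 = 1 / I\<close>, where \<open>I\<close> is the integral in the statement.
  Conversely, the normalised solution of the recursion has a finite mean exit rate, which suffices
  for it to be stationary.
\<close>

section \<open>Stationarity and balance\<close>

text \<open>Truncating to finitely many intermediate states loses only nonnegative mass, and a
  finite sum allows limits in time to be taken term by term.\<close>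

lemma sum_le_pmf_bind:
  assumes "finite A"
  shows "(\<Sum>x\<in>A. pmf p x * pmf (f x) y) \<le> pmf (bind_pmf p f) y"
proof -
  have "(\<Sum>x\<in>A. pmf p x * pmf (f x) y) = measure_pmf.expectation p (\<lambda>x. indicator A x * pmf (f x) y)"
    using assms by (subst integral_measure_pmf[of A]) (auto simp: indicator_def split: if_splits)
  also have "\<dots> \<le> measure_pmf.expectation p (\<lambda>x. pmf (f x) y)"
    by (intro integral_mono measure_pmf.integrable_const_bound[where B=1])
       (auto simp: indicator_def pmf_le_1)
  finally show ?thesis by (simp add: pmf_bind)
qed

lemma transition_rate_tendsto:
  assumes "markov_chain_with_rates P q" "x \<noteq> y"
  shows "((\<lambda>t. pmf (P t x) y / t) \<longlongrightarrow> q x y) (at_right 0)"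
proof -
  have "((\<lambda>t. pmf (P t x) y) has_real_derivative q x y) (at_right 0)" "P 0 x = return_pmf x"
    using assms
    by (auto simp: markov_chain_with_rates_def has_transition_rates_def markov_transition_function_def)
  then show ?thesis
    using assms(2) by (simp add: has_field_derivative_iff)
qed

lemma exit_rate_tendsto:
  assumes "markov_chain_with_rates P q" "(q x has_sum c) (- {x})"
  shows "((\<lambda>t. (1 - pmf (P t x) x) / t) \<longlongrightarrow> c) (at_right 0)"
proof -
  from assms obtain c' where "(q x has_sum c') (- {x})"
    and deriv: "((\<lambda>t. pmf (P t x) x) has_real_derivative - c') (at_right 0)"
    unfolding markov_chain_with_rates_def has_transition_rates_def by blast
  then have "c' = c"
    using assms(2) by (metis has_sum_unique)
  moreover have "P 0 x = return_pmf x"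
    using assms(1) by (simp add: markov_chain_with_rates_def markov_transition_function_def)
  ultimately have "((\<lambda>t. - ((pmf (P t x) x - 1) / t)) \<longlongrightarrow> - (- c)) (at_right 0)"
    using deriv by (intro tendsto_minus) (simp add: has_field_derivative_iff)
  then show ?thesis
    by (simp add: minus_divide_left)
qed

text \<open>The return probability is supermultiplicative in time, so Bernoulli's inequality gives
  \<open>1 - P t x x \<le> n * (1 - P (t / n) x x)\<close>, and the right-hand side tends to \<open>c * t\<close>.\<close>

lemma exit_probability_le:
  assumes mc: "markov_chain_with_rates P q" and c: "(q x has_sum c) (- {x})" and "t > 0"
  shows "1 - pmf (P t x) x \<le> c * t"
proof -
  \<comment> \<open>Keeps only the paths that are at \<open>x\<close> at the intermediate time
    \<open>s\<close>.\<close>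
  have super: "pmf (P s x) x * pmf (P s' x) x \<le> pmf (P (s + s') x) x" if "s \<ge> 0" "s' \<ge> 0" for s s'
    using sum_le_pmf_bind[of "{x}" "P s x" "P s'" x] mc that
    by (simp add: markov_chain_with_rates_def markov_transition_function_def)
  have pow: "pmf (P s x) x ^ n \<le> pmf (P (real n * s) x) x" if "s \<ge> 0" for s n
  proof (induction n)
    case 0
    then show ?case
      using mc by (simp add: markov_chain_with_rates_def markov_transition_function_def)
  next
    case (Suc n)
    have "pmf (P s x) x ^ Suc n \<le> pmf (P s x) x * pmf (P (real n * s) x) x"
      using Suc by (simp add: mult_left_mono)
    also have "\<dots> \<le> pmf (P (s + real n * s) x) x"
      using that by (intro super) auto
    finally show ?case
      by (simp add: algebra_simps)
  qed
  define h where "h n = t / real (Suc n)" for n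
  have h_pos: "h n > 0" for n
    using \<open>t > 0\<close> by (simp add: h_def)
  have "h \<longlonglongrightarrow> 0"
    unfolding h_def using LIMSEQ_Suc[OF lim_const_over_n[of t]] by simp
  then have "filterlim h (at_right 0) sequentially"
    using h_pos by (simp add: tendsto_imp_filterlim_at_right)
  then have "(\<lambda>n. t * ((1 - pmf (P (h n) x) x) / h n)) \<longlonglongrightarrow> t * c"
    by (intro tendsto_mult tendsto_const filterlim_compose[OF exit_rate_tendsto[OF mc c]])
  moreover have "1 - pmf (P t x) x \<le> t * ((1 - pmf (P (h n) x) x) / h n)" for n
  proof -
    have "1 + real (Suc n) * (pmf (P (h n) x) x - 1) \<le> (1 + (pmf (P (h n) x) x - 1)) ^ Suc n"
      by (rule Bernoulli_inequality) simp
    also have "\<dots> \<le> pmf (P t x) x"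
      using pow[of "h n" "Suc n"] h_pos[of n] by (simp add: h_def)
    also have "real (Suc n) = t / h n"
      using \<open>t > 0\<close> by (simp add: h_def)
    finally show ?thesis
      using h_pos[of n] by (simp add: field_simps)
  qed
  ultimately have "1 - pmf (P t x) x \<le> t * c"
    by (intro LIMSEQ_le_const) auto
  then show ?thesis
    by (simp add: mult.commute)
qed

text \<open>Stationarity bounds the mass arriving from \<open>F\<close> during time \<open>t\<close>
  by the mass leaving \<open>y\<close>; dividing by \<open>t\<close> gives rates in the limit. Only
  an inequality results, since sources outside \<open>F\<close> are dropped.\<close>

lemma stationary_imp_subinvariant:
  assumes mc: "markov_chain_with_rates P q" and "stationary_distribution P \<pi>"
    and c: "(q y has_sum c) (- {y})" and F: "finite F" "y \<notin> F"
  shows "(\<Sum>x\<in>F. pmf \<pi> x * q x y) \<le> pmf \<pi> y * c"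
proof -
  have "((\<lambda>t. \<Sum>x\<in>F. pmf \<pi> x * (pmf (P t x) y / t)) \<longlongrightarrow> (\<Sum>x\<in>F. pmf \<pi> x * q x y)) (at_right 0)"
    using F by (intro tendsto_sum tendsto_mult tendsto_const transition_rate_tendsto[OF mc]) auto
  moreover have "((\<lambda>t. pmf \<pi> y * ((1 - pmf (P t y) y) / t)) \<longlongrightarrow> pmf \<pi> y * c) (at_right 0)"
    by (intro tendsto_mult tendsto_const exit_rate_tendsto[OF mc c])
  moreover have "\<forall>\<^sub>F t in at_right 0. (\<Sum>x\<in>F. pmf \<pi> x * (pmf (P t x) y / t))
      \<le> pmf \<pi> y * ((1 - pmf (P t y) y) / t)"
    unfolding eventually_at_filter
  proof (intro always_eventually allI impI)
    fix t :: real assume "t \<in> {0<..}"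
    then have "t > 0" by simp
    then have "bind_pmf \<pi> (P t) = \<pi>"
      using assms(2) by (simp add: stationary_distribution_def)
    then have "pmf \<pi> y * pmf (P t y) y + (\<Sum>x\<in>F. pmf \<pi> x * pmf (P t x) y) \<le> pmf \<pi> y"
      using sum_le_pmf_bind[of "insert y F" \<pi> "P t" y] F by simp
    then have "(\<Sum>x\<in>F. pmf \<pi> x * pmf (P t x) y) / t \<le> pmf \<pi> y * (1 - pmf (P t y) y) / t"
      using \<open>t > 0\<close> by (intro divide_right_mono) (auto simp: algebra_simps)
    then show "(\<Sum>x\<in>F. pmf \<pi> x * (pmf (P t x) y / t)) \<le> pmf \<pi> y * ((1 - pmf (P t y) y) / t)"
      by (simp add: sum_divide_distrib)
  qed
  ultimately show ?thesis
    by (intro tendsto_le[OF trivial_limit_at_right_real])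
qed

section \<open>From balance to stationarity\<close>

lemma pmf_expectation_count_space:
  fixes f :: "'a \<Rightarrow> real"
  shows "measure_pmf.expectation p f = (\<integral>y. pmf p y * f y \<partial>count_space UNIV)"
  by (subst measure_pmf_eq_density, subst integral_density) auto

text \<open>As \<open>f\<close> lies between 0 and 1, the difference is largest when
  \<open>f\<close> is the indicator of the set where \<open>p\<close> exceeds \<open>p'\<close>. The
  right-hand side is the total variation distance; with a transition probability as
  \<open>f\<close>, this is the contraction property of a Markov kernel.\<close>

lemma expectation_diff_le:
  fixes f :: "'a \<Rightarrow> real"
  assumes "\<And>y. 0 \<le> f y" "\<And>y. f y \<le> 1"
  shows "measure_pmf.expectation p f - measure_pmf.expectation p' f
    \<le> (\<integral>y. max 0 (pmf p y - pmf p' y) \<partial>count_space UNIV)"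
proof -
  have [simp]: "integrable (count_space UNIV) (\<lambda>y. pmf p y * f y)" for p
    by (rule Bochner_Integration.integrable_bound[OF integrable_pmf[of UNIV p]])
       (use assms in \<open>auto simp: abs_mult mult_left_le\<close>)
  have "measure_pmf.expectation p f - measure_pmf.expectation p' f
      = (\<integral>y. pmf p y * f y - pmf p' y * f y \<partial>count_space UNIV)"
    by (simp add: pmf_expectation_count_space)
  also have "\<dots> \<le> (\<integral>y. max 0 (pmf p y - pmf p' y) \<partial>count_space UNIV)"
  proof (intro integral_mono integrable_max)
    show "pmf p y * f y - pmf p' y * f y \<le> max 0 (pmf p y - pmf p' y)" for y
      using mult_left_le[OF assms(2)[of y], of "pmf p y - pmf p' y"] assms(1)[of y]
      by (cases "pmf p' y \<le> pmf p y") (auto simp: algebra_simps max_def mult_left_mono)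
  qed (auto simp: integrable_pmf)
  finally show ?thesis .
qed

text \<open>The \<open>l\<^sub>1\<close> distance of \<open>\<pi>\<close> and \<open>\<pi> P\<^sub>h\<close> is \<open>o(h)\<close> by dominated convergence; the domination comes from
  \<open>exit_probability_le\<close>. As the \<open>P\<^sub>h\<close> are contractions, \<open>n\<close> steps of length \<open>t / n\<close> move \<open>\<pi>\<close> by
  at most \<open>n o(1 / n)\<close>.\<close>

lemma invariant_imp_stationary:
  fixes \<pi> :: "'a pmf"
  assumes mc: "markov_chain_with_rates P q"
    and c: "\<And>y. (q y has_sum c y) (- {y})"
    and F: "\<And>y. finite (F y)" "\<And>y. y \<notin> F y"
    and balance: "\<And>y. pmf \<pi> y * c y = (\<Sum>x\<in>F y. pmf \<pi> x * q x y)"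
    and integrable: "integrable (measure_pmf \<pi>) c"
  shows "stationary_distribution P \<pi>"
  unfolding stationary_distribution_def
proof (intro allI impI)
  fix t :: real assume "t \<ge> 0"
  have P0: "P 0 = return_pmf" and P_add: "P (s + s') x = bind_pmf (P s x) (P s')"
    if "s \<ge> 0" "s' \<ge> 0" for s s' x
    using mc that by (auto simp: markov_chain_with_rates_def markov_transition_function_def)
  show "bind_pmf \<pi> (P t) = \<pi>"
  proof (cases "t = 0")
    case True
    then show ?thesis
      using P0[of 0 0] by (simp add: bind_return_pmf')
  next
    case False
    with \<open>t \<ge> 0\<close> have "t > 0" by simp
    define h where "h n = t / real (Suc n)" for n
    \<comment> \<open>Only the deficit of the evolved law is measured: truncated sums bound that law
      from below, and equality of total masses settles the excess at the end.\<close>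
    define loss where "loss n y = max 0 (pmf \<pi> y - pmf (bind_pmf \<pi> (P (h n))) y)" for n y
    have h_pos: "h n > 0" for n
      using \<open>t > 0\<close> by (simp add: h_def)
    have "h \<longlonglongrightarrow> 0"
      unfolding h_def using LIMSEQ_Suc[OF lim_const_over_n[of t]] by simp
    then have h: "filterlim h (at_right 0) sequentially"
      using h_pos by (simp add: tendsto_imp_filterlim_at_right)

    have loss_le: "loss n y / h n \<le> max 0 (pmf \<pi> y * ((1 - pmf (P (h n) y) y) / h n)
        - (\<Sum>x\<in>F y. pmf \<pi> x * (pmf (P (h n) x) y / h n)))" for n y
    proof -
      have "pmf \<pi> y * pmf (P (h n) y) y + (\<Sum>x\<in>F y. pmf \<pi> x * pmf (P (h n) x) y)
          \<le> pmf (bind_pmf \<pi> (P (h n))) y"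
        using sum_le_pmf_bind[of "insert y (F y)" \<pi> "P (h n)" y] F by simp
      then have "loss n y \<le> max 0 (pmf \<pi> y * (1 - pmf (P (h n) y) y)
          - (\<Sum>x\<in>F y. pmf \<pi> x * pmf (P (h n) x) y))"
        unfolding loss_def by (intro max.mono) (auto simp: algebra_simps)
      then have "loss n y / h n \<le> max 0 (pmf \<pi> y * (1 - pmf (P (h n) y) y)
          - (\<Sum>x\<in>F y. pmf \<pi> x * pmf (P (h n) x) y)) / h n"
        using h_pos[of n] by (intro divide_right_mono) auto
      also have "\<dots> = max 0 (pmf \<pi> y * ((1 - pmf (P (h n) y) y) / h n)
          - (\<Sum>x\<in>F y. pmf \<pi> x * (pmf (P (h n) x) y / h n)))"
        using h_pos[of n]
        by (simp add: max_divide_distrib_right sum_divide_distrib diff_divide_distrib right_diff_distrib)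
      finally show ?thesis .
    qed
    have loss_nonneg: "0 \<le> loss n y" for n y
      by (simp add: loss_def)
    have "(\<lambda>n. loss n y / h n) \<longlonglongrightarrow> 0" for y
    proof (rule tendsto_sandwich[OF _ _ tendsto_const])
      have "(\<lambda>n. max 0 (pmf \<pi> y * ((1 - pmf (P (h n) y) y) / h n)
            - (\<Sum>x\<in>F y. pmf \<pi> x * (pmf (P (h n) x) y / h n))))
          \<longlonglongrightarrow> max 0 (pmf \<pi> y * c y - (\<Sum>x\<in>F y. pmf \<pi> x * q x y))"
        using F by (intro tendsto_max tendsto_const tendsto_diff tendsto_mult tendsto_sum
            filterlim_compose[OF exit_rate_tendsto[OF mc c] h]
            filterlim_compose[OF transition_rate_tendsto[OF mc] h]) auto
      then show "(\<lambda>n. max 0 (pmf \<pi> y * ((1 - pmf (P (h n) y) y) / h n)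
            - (\<Sum>x\<in>F y. pmf \<pi> x * (pmf (P (h n) x) y / h n)))) \<longlonglongrightarrow> 0"
        by (simp add: balance)
    qed (use loss_le loss_nonneg h_pos in \<open>auto simp: less_imp_le\<close>)
    moreover have "loss n y / h n \<le> pmf \<pi> y * c y" for n y
    proof -
      have "(1 - pmf (P (h n) y) y) / h n \<le> c y"
        using exit_probability_le[OF mc c h_pos] h_pos[of n] by (simp add: field_simps)
      then have "pmf \<pi> y * ((1 - pmf (P (h n) y) y) / h n) \<le> pmf \<pi> y * c y"
        by (intro mult_left_mono) auto
      moreover have "0 \<le> (\<Sum>x\<in>F y. pmf \<pi> x * (pmf (P (h n) x) y / h n))"
        using h_pos[of n] by (intro sum_nonneg mult_nonneg_nonneg divide_nonneg_pos) auto
      moreover have "0 \<le> pmf \<pi> y * ((1 - pmf (P (h n) y) y) / h n)"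
        using h_pos[of n] by (intro mult_nonneg_nonneg divide_nonneg_pos) (auto simp: pmf_le_1)
      ultimately show ?thesis
        using loss_le[of n y] by (auto simp: max_def split: if_splits)
    qed
    moreover have "integrable (count_space UNIV) (\<lambda>y. pmf \<pi> y * c y)"
      using integrable by (subst (asm) measure_pmf_eq_density, subst (asm) integrable_density) auto
    ultimately have "(\<lambda>n. \<integral>y. loss n y / h n \<partial>count_space UNIV)
        \<longlonglongrightarrow> integral\<^sup>L (count_space UNIV) (\<lambda>y::'a. 0)"
      using loss_nonneg h_pos
      by (intro integral_dominated_convergence[where w="\<lambda>y. pmf \<pi> y * c y"])
         (auto simp: abs_of_nonneg less_imp_le)
    then have lim: "(\<lambda>n. t * (\<integral>y. loss n y / h n \<partial>count_space UNIV)) \<longlonglongrightarrow> 0"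
      using tendsto_mult_right_zero by fastforce

    have "pmf \<pi> z \<le> pmf (bind_pmf \<pi> (P t)) z" for z
    proof -
      \<comment> \<open>The short step comes first, so its deficit is \<open>loss n\<close>, and the
        kernel \<open>P s\<close> applied afterwards does not enlarge it.\<close>
      have step: "pmf (bind_pmf \<pi> (P s)) z - pmf (bind_pmf \<pi> (P (h n + s))) z
          \<le> (\<integral>y. loss n y \<partial>count_space UNIV)" if "s \<ge> 0" for s n
      proof -
        have "P (h n + s) = (\<lambda>x. bind_pmf (P (h n) x) (P s))"
          using P_add that h_pos[of n] by (intro ext) auto
        then have "bind_pmf \<pi> (P (h n + s)) = bind_pmf (bind_pmf \<pi> (P (h n))) (P s)"
          by (simp add: bind_assoc_pmf)
        then show ?thesis
          unfolding loss_def
          by (simp add: pmf_bind[of _ "P s"] expectation_diff_le pmf_le_1 del: bind_assoc_pmf)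
      qed
      have "pmf \<pi> z - pmf (bind_pmf \<pi> (P (real j * h n))) z
          \<le> real j * (\<integral>y. loss n y \<partial>count_space UNIV)" for j n
      proof (induction j)
        case 0
        then show ?case
          using P0[of 0 0] by (simp add: bind_return_pmf')
      next
        case (Suc j)
        then show ?case
          using step[of "real j * h n" n] h_pos[of n] by (simp add: algebra_simps)
      qed
      \<comment> \<open>\<open>Suc n\<close> steps of length \<open>h n\<close> make up time
        \<open>t\<close>, so the accumulated deficit is \<open>t\<close> times the integral known to
        tend to 0.\<close>
      from this[where j="Suc n" and n=n for n]
      have "pmf \<pi> z - pmf (bind_pmf \<pi> (P t)) z
          \<le> t * (\<integral>y. loss n y / h n \<partial>count_space UNIV)" for n
        using \<open>t > 0\<close> by (simp add: h_def mult.commute del: of_nat_Suc)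
      then have "pmf \<pi> z - pmf (bind_pmf \<pi> (P t)) z \<le> 0"
        using LIMSEQ_le_const[OF lim] by blast
      then show ?thesis by simp
    qed
    then show ?thesis
      \<comment> \<open>Two laws of total mass 1 that are ordered pointwise coincide.\<close>
      by (metis pmf_neq_exists_less not_le)
  qed
qed

lemma sums_pmf_nat: "pmf p sums (1 :: real)" for p :: "nat pmf"
proof -
  have "(\<integral>n. pmf p n \<partial>count_space UNIV) = 1"
    by (simp add: integral_pmf)
  then show ?thesis
    using sums_integral_count_space_nat[OF integrable_pmf[of UNIV p]] by simp
qed

lemma expectation_nat_pmf:
  fixes \<pi> :: "nat pmf"
  assumes "(\<lambda>n. real n * pmf \<pi> n) sums s"
  shows "integrable (measure_pmf \<pi>) real" "measure_pmf.expectation \<pi> real = s"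
proof -
  have int: "integrable (count_space UNIV) (\<lambda>n. pmf \<pi> n * real n)"
    using assms by (simp add: integrable_count_space_nat_iff sums_iff mult.commute abs_mult)
  then show "integrable (measure_pmf \<pi>) real"
    by (subst measure_pmf_eq_density, subst integrable_density) auto
  show "measure_pmf.expectation \<pi> real = s"
    unfolding pmf_expectation_count_space
    using sums_integral_count_space_nat[OF int] assms by (simp add: mult.commute sums_unique2)
qed

section \<open>Power series on the unit interval\<close>

lemma summable_powser_unit:
  fixes a :: "nat \<Rightarrow> real"
  assumes "summable (\<lambda>n. \<bar>a n\<bar>)" "\<bar>z\<bar> \<le> 1"
  shows "summable (\<lambda>n. a n * z ^ n)"
  using assms
  by (intro summable_comparison_test'[OF assms(1), of 0])
     (auto simp: abs_mult power_abs power_le_one mult_left_le)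

lemma continuous_on_powser_unit_interval:
  fixes a :: "nat \<Rightarrow> real"
  assumes "summable (\<lambda>n. \<bar>a n\<bar>)"
  shows "continuous_on {0..1} (\<lambda>x. \<Sum>n. a n * x ^ n)"
proof (rule uniform_limit_theorem)
  show "uniform_limit {0..1} (\<lambda>n x. \<Sum>i<n. a i * x ^ i) (\<lambda>x. \<Sum>n. a n * x ^ n) sequentially"
    using assms
    by (intro Weierstrass_m_test[where M="\<lambda>n. \<bar>a n\<bar>"]) (auto simp: abs_mult power_le_one mult_left_le)
qed (auto intro!: always_eventually continuous_intros)

section \<open>Cut equations of the batch queue\<close>

text \<open>Batches of size distribution \<open>p\<close> with mean \<open>m\<close> arrive at rate \<open>\<Lambda>\<close>, and state \<open>n > 0\<close> loses one
  share at rate \<open>\<mu> + n \<theta>\<close>.\<close>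

locale batch_queue =
  fixes \<mu> \<theta> \<Lambda> m :: real and p :: "nat \<Rightarrow> real"
  assumes rates_pos: "0 < \<mu>" "0 < \<theta>" "0 < \<Lambda>"
    and p_nonneg: "\<And>n. 0 \<le> p n"
    and p_0: "p 0 = 0"
    and p_sums: "p sums 1"
    and mean_sums: "(\<lambda>n. real n * p n) sums m"
begin

text \<open>Survival function of the batch size: an arrival in state \<open>j\<close> jumps across
  the cut above \<open>j + n\<close> with probability \<open>tail n\<close>.\<close>

definition tail :: "nat \<Rightarrow> real" where
  "tail n = 1 - (\<Sum>i\<le>n. p i)"

lemma tail_0 [simp]: "tail 0 = 1"
  by (simp add: tail_def p_0)

lemma tail_Suc: "tail (Suc n) = tail n - p (Suc n)"
  by (simp add: tail_def)

lemma tail_nonneg: "0 \<le> tail n"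
  using sum_le_suminf[of p "{..n}"] p_sums p_nonneg by (simp add: tail_def sums_iff)

text \<open>Summation by parts. The boundary term \<open>real N * tail N\<close> vanishes because it
  is at most the remainder of the mean series.\<close>

lemma tail_sums: "tail sums m"
proof -
  have sum_tail: "(\<Sum>n<N. tail n) = (\<Sum>i\<le>N. real i * p i) + real N * tail N" for N
    by (induction N) (auto simp: tail_Suc algebra_simps)
  have upper: "real N * tail N \<le> m - (\<Sum>i\<le>N. real i * p i)" for N
  proof -
    have "(\<lambda>i. real N * p (i + Suc N)) sums (real N * tail N)"
      using p_sums
      by (intro sums_mult) (simp only: sums_iff_shift tail_def lessThan_Suc_atMost diff_add_cancel)
    moreover have "(\<lambda>i. real (i + Suc N) * p (i + Suc N)) sums (m - (\<Sum>i\<le>N. real i * p i))"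
      using mean_sums sums_iff_shift[of "\<lambda>i. real i * p i" "Suc N"]
      by (simp only: lessThan_Suc_atMost diff_add_cancel)
    ultimately show ?thesis
      by (rule sums_le[rotated 1]) (intro mult_right_mono p_nonneg, simp)
  qed
  have mean: "(\<lambda>N. \<Sum>i\<le>N. real i * p i) \<longlonglongrightarrow> m"
    using mean_sums by (simp add: sums_def_le)
  have "(\<lambda>N. real N * tail N) \<longlonglongrightarrow> 0"
  proof (rule tendsto_sandwich[OF _ _ tendsto_const])
    show "(\<lambda>N. m - (\<Sum>i\<le>N. real i * p i)) \<longlonglongrightarrow> 0"
      using tendsto_diff[OF tendsto_const mean, of m] by simp
  qed (auto simp: upper tail_nonneg)
  from tendsto_add[OF mean this] show ?thesis
    by (simp add: sums_def sum_tail)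
qed

text \<open>The probability flows across the cut between \<open>{..n}\<close> and \<open>{n<..}\<close> when state \<open>j\<close> has
  weight \<open>r j\<close>.\<close>

definition upflow :: "(nat \<Rightarrow> real) \<Rightarrow> nat \<Rightarrow> real" where
  "upflow r n = \<Lambda> * (\<Sum>j\<le>n. r j * tail (n - j))"

definition downflow :: "(nat \<Rightarrow> real) \<Rightarrow> nat \<Rightarrow> real" where
  "downflow r n = (\<mu> + real (Suc n) * \<theta>) * r (Suc n)"

definition exit_rate :: "nat \<Rightarrow> real" where
  "exit_rate n = \<Lambda> + (if n = 0 then 0 else \<mu> + real n * \<theta>)"

lemma upflow_0: "upflow r 0 = exit_rate 0 * r 0"
  by (simp add: upflow_def exit_rate_def)

text \<open>Raising the cut by one adds the upward jumps of state \<open>Suc n\<close>, that is its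
  exit flow without its departures, and removes the arrivals from below that end exactly in
  \<open>Suc n\<close>.\<close>

lemma upflow_Suc:
  "upflow r (Suc n) = upflow r n + exit_rate (Suc n) * r (Suc n) - downflow r n
     - (\<Sum>j<Suc n. r j * (\<Lambda> * p (Suc n - j)))"
proof -
  have "(\<Sum>j\<le>n. r j * tail (Suc n - j)) = (\<Sum>j\<le>n. r j * tail (n - j) - r j * p (Suc n - j))"
    by (intro sum.cong) (auto simp: Suc_diff_le tail_Suc algebra_simps)
  then have "\<Lambda> * (\<Sum>j\<le>n. r j * tail (Suc n - j))
      = upflow r n - (\<Sum>j\<le>n. r j * (\<Lambda> * p (Suc n - j)))"
    by (simp add: upflow_def sum_subtractf right_diff_distrib sum_distrib_left mult_ac)
  then show ?thesis
    by (simp add: upflow_def[of r "Suc n"] exit_rate_def downflow_def lessThan_Suc_atMost algebra_simps)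
qed

lemma upflow_sums:
  assumes "\<And>n. 0 \<le> r n" "r sums s"
  shows "upflow r sums (\<Lambda> * (s * m))"
proof -
  have "(\<lambda>n. \<Sum>j\<le>n. r j * tail (n - j)) sums ((\<Sum>n. r n) * (\<Sum>n. tail n))"
    using assms tail_sums tail_nonneg by (intro Cauchy_product_sums) (auto simp: sums_iff)
  then have "(\<lambda>n. \<Sum>j\<le>n. r j * tail (n - j)) sums (s * m)"
    using assms(2) tail_sums by (simp add: sums_iff)
  then show ?thesis
    unfolding upflow_def by (rule sums_mult)
qed

text \<open>The net upflow across the cuts is nonnegative and nondecreasing in \<open>n\<close>, and it is bounded by the
  upflow, which is summable; so it vanishes.\<close>

lemma subinvariant_imp_cut_balance:
  assumes r: "\<And>n. 0 \<le> r n" "summable r"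
    and sub_0: "downflow r 0 \<le> exit_rate 0 * r 0"
    and sub_Suc: "\<And>n. (\<Sum>j<Suc n. r j * (\<Lambda> * p (Suc n - j))) + downflow r (Suc n)
      \<le> exit_rate (Suc n) * r (Suc n)"
  shows "downflow r n = upflow r n"
proof -
  define net where "net n = upflow r n - downflow r n" for n
  have net_mono: "mono net"
    unfolding net_def using sub_Suc by (intro mono_iff_le_Suc[THEN iffD2]) (simp add: upflow_Suc algebra_simps)
  have "0 \<le> net 0"
    using sub_0 by (simp add: net_def upflow_0)
  then have "0 \<le> net n"
    using monoD[OF net_mono, of 0 n] by simp
  moreover have "upflow r \<longlonglongrightarrow> 0"
    using upflow_sums[OF r(1) summable_sums[OF r(2)]] by (simp add: sums_iff summable_LIMSEQ_zero)
  moreover have "net n \<le> upflow r k" if "n \<le> k" for k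
  proof -
    have "net n \<le> net k"
      using net_mono that by (rule monoD)
    also have "\<dots> \<le> upflow r k"
      using r(1)[of "Suc k"] rates_pos by (simp add: net_def downflow_def)
    finally show ?thesis .
  qed
  then have "net n \<le> 0"
    using \<open>upflow r \<longlonglongrightarrow> 0\<close> by (intro LIMSEQ_le_const) auto
  ultimately show ?thesis
    by (simp add: net_def)
qed

lemma cut_balance_imp_balance:
  assumes "\<And>n. downflow r n = upflow r n"
  shows "exit_rate 0 * r 0 = downflow r 0"
    and "exit_rate (Suc n) * r (Suc n)
      = (\<Sum>j<Suc n. r j * (\<Lambda> * p (Suc n - j))) + downflow r (Suc n)"
  using upflow_Suc[of r n] by (simp_all add: assms upflow_0)

section \<open>Solution of the cut recursion\<close>

text \<open>The cut equation at \<open>n\<close> solved for state \<open>Suc n\<close>, which leaves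
  only the value at 0 free; it is set to 1.\<close>

fun weight :: "nat \<Rightarrow> real" where
  "weight 0 = 1"
| "weight (Suc n) = \<Lambda> * (\<Sum>j\<le>n. weight j * tail (n - j)) / (\<mu> + real (Suc n) * \<theta>)"

lemma denominator_pos: "0 < \<mu> + real n * \<theta>"
  using rates_pos by (intro add_pos_nonneg) auto

lemma weight_nonneg: "0 \<le> weight n"
proof (induction n rule: less_induct)
  case (less n)
  then show ?case
    using denominator_pos[of n] rates_pos
    by (cases n) (auto intro!: divide_nonneg_pos mult_nonneg_nonneg sum_nonneg simp: tail_nonneg simp del: of_nat_Suc)
qed

lemma weight_cut_balance: "downflow weight n = upflow weight n"
  using denominator_pos[of "Suc n"] by (simp add: downflow_def upflow_def del: of_nat_Suc)

lemma cut_balance_imp_eq_weight: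
  assumes "\<And>n. downflow r n = upflow r n"
  shows "r n = r 0 * weight n"
proof (induction n rule: less_induct)
  case (less n)
  show ?case
  proof (cases n)
    case (Suc k)
    have "(\<mu> + real n * \<theta>) * r n = \<Lambda> * (\<Sum>j\<le>k. r j * tail (k - j))"
      using assms[of k] by (simp add: downflow_def upflow_def Suc)
    also have "(\<Sum>j\<le>k. r j * tail (k - j)) = r 0 * (\<Sum>j\<le>k. weight j * tail (k - j))"
      unfolding sum_distrib_left
    proof (intro sum.cong refl)
      fix j assume "j \<in> {..k}"
      then have "r j = r 0 * weight j"
        by (intro less) (simp add: Suc)
      then show "r j * tail (k - j) = r 0 * (weight j * tail (k - j))"
        by (metis mult.assoc)
    qed
    finally have "r n = \<Lambda> * (r 0 * (\<Sum>j\<le>k. weight j * tail (k - j))) / (\<mu> + real n * \<theta>)"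
      using denominator_pos[of n] by (simp add: eq_divide_eq mult.commute)
    then show ?thesis
      by (simp add: Suc)
  qed simp
qed

text \<open>Summing the cut balance gives \<open>\<Sum>i<n. i \<theta> weight i \<le> \<Lambda> m (\<Sum>i<n. weight i)\<close>, and beyond \<open>N\<close> the
  left-hand side has the larger coefficients.\<close>

lemma summable_weight: "summable weight"
proof -
  define S where "S n = (\<Sum>i<n. weight i)" for n
  have m_nonneg: "0 \<le> m"
    using tail_sums tail_nonneg by (metis sums_le sums_zero)
  \<comment> \<open>From \<open>N\<close> on, departures outweigh the inflow coefficient
    \<open>\<Lambda> * m\<close> by at least 1; this surplus bounds the partial sums.\<close>
  obtain N :: nat where "(\<Lambda> * m + 1) / \<theta> \<le> real N"
    using real_arch_simple by blast
  then have N: "\<Lambda> * m + 1 \<le> real N * \<theta>"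
    using rates_pos by (simp add: field_simps)
  have S_mono: "S i \<le> S j" if "i \<le> j" for i j
    unfolding S_def using that by (intro sum_mono2) (auto simp: weight_nonneg)
  have upflow_le: "(\<Sum>i<n. upflow weight i) \<le> \<Lambda> * (m * S n)" for n
  proof -
    have "(\<Sum>i<n. \<Sum>j\<le>i. weight j * tail (i - j))
        = (\<Sum>(i, j)\<in>(SIGMA i:{..<n}. {..i}). weight j * tail (i - j))"
      by (simp add: sum.Sigma)
    also have "\<dots> = (\<Sum>(j, i)\<in>(SIGMA j:{..<n}. {j..<n}). weight j * tail (i - j))"
      by (rule sum.reindex_bij_witness[of _ prod.swap prod.swap]) auto
    also have "\<dots> = (\<Sum>j<n. weight j * (\<Sum>i=j..<n. tail (i - j)))"
      by (simp add: sum.Sigma[symmetric] sum_distrib_left)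
    also have "\<dots> \<le> (\<Sum>j<n. weight j * m)"
    proof (intro sum_mono mult_left_mono weight_nonneg)
      fix j assume "j \<in> {..<n}"
      then have "(\<Sum>i=j..<n. tail (i - j)) = (\<Sum>i<n - j. tail i)"
        by (intro sum.reindex_bij_witness[of _ "\<lambda>i. i + j" "\<lambda>i. i - j"]) auto
      also have "\<dots> \<le> m"
        using sum_le_suminf[of tail "{..<n - j}"] tail_sums tail_nonneg by (simp add: sums_iff)
      finally show "(\<Sum>i=j..<n. tail (i - j)) \<le> m" .
    qed
    finally show ?thesis
      using rates_pos
      by (simp add: upflow_def S_def sum_distrib_left[symmetric] sum_distrib_right[symmetric] mult.commute)
  qed
  \<comment> \<open>The correction term covers the states up to \<open>N\<close>, where the
    departure rate may still be too small.\<close>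
  have weight_le: "(\<Lambda> * m + 1) * weight (Suc i)
      \<le> downflow weight i + (if i < N then (\<Lambda> * m + 1) * weight (Suc i) else 0)" for i
  proof (cases "i < N")
    case True
    then show ?thesis
      using rates_pos weight_nonneg[of "Suc i"] by (simp add: downflow_def del: weight.simps)
  next
    case False
    then have "real N * \<theta> \<le> real (Suc i) * \<theta>"
      using rates_pos by (intro mult_right_mono) auto
    then have "\<Lambda> * m + 1 \<le> \<mu> + real (Suc i) * \<theta>"
      using N rates_pos by linarith
    then show ?thesis
      using False weight_nonneg[of "Suc i"]
      by (simp add: downflow_def mult_right_mono del: weight.simps of_nat_Suc)
  qed
  have "S n \<le> (\<Lambda> * m + 1) * S (Suc N)" for n
  proof -
    have Suc_sum: "S (Suc k) = 1 + (\<Sum>i<k. weight (Suc i))" for k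
      unfolding S_def by (subst sum.lessThan_Suc_shift) simp
    have "(\<Lambda> * m + 1) * (\<Sum>i<n. weight (Suc i))
        \<le> (\<Sum>i<n. downflow weight i) + (\<Sum>i<n. if i < N then (\<Lambda> * m + 1) * weight (Suc i) else 0)"
      unfolding sum_distrib_left sum.distrib[symmetric] by (intro sum_mono weight_le)
    also have "(\<Sum>i<n. downflow weight i) \<le> \<Lambda> * (m * S n)"
      using upflow_le by (simp add: weight_cut_balance)
    also have "(\<Sum>i<n. if i < N then (\<Lambda> * m + 1) * weight (Suc i) else 0)
        \<le> (\<Lambda> * m + 1) * (\<Sum>i<N. weight (Suc i))"
    proof -
      have "(\<Sum>i<n. if i < N then (\<Lambda> * m + 1) * weight (Suc i) else 0)
          = (\<Sum>i\<in>{..<n} \<inter> {..<N}. (\<Lambda> * m + 1) * weight (Suc i))"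
        by (simp add: sum.inter_restrict del: weight.simps)
      also have "\<dots> \<le> (\<Sum>i<N. (\<Lambda> * m + 1) * weight (Suc i))"
        using m_nonneg rates_pos weight_nonneg
        by (intro sum_mono2) (auto simp del: weight.simps)
      finally show ?thesis
        by (simp only: sum_distrib_left)
    qed
    finally have "(\<Lambda> * m + 1) * S (Suc n) \<le> \<Lambda> * m * S n + (\<Lambda> * m + 1) * S (Suc N)"
      by (simp add: Suc_sum algebra_simps del: weight.simps)
    \<comment> \<open>Lowering \<open>S (Suc n)\<close> to \<open>S n\<close> lets the term
      \<open>\<Lambda> * m * S n\<close> cancel.\<close>
    moreover have "(\<Lambda> * m + 1) * S n \<le> (\<Lambda> * m + 1) * S (Suc n)"
      using m_nonneg rates_pos by (intro mult_left_mono S_mono) auto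
    ultimately show ?thesis
      by (simp add: algebra_simps)
  qed
  from this[of "Suc n" for n] show ?thesis
    unfolding S_def lessThan_Suc_atMost by (intro bounded_imp_summable[OF weight_nonneg])
qed

text \<open>The cut equations are summed over all cuts. The market-order part of the downflow
  contributes \<open>\<mu> * (s - r 0)\<close>, and what remains is \<open>\<theta>\<close> times
  the mean, which is thereby finite.\<close>

lemma cut_balance_mean_sums:
  assumes "\<And>n. 0 \<le> r n" "r sums s" "\<And>n. downflow r n = upflow r n"
  shows "(\<lambda>n. real n * r n) sums ((\<Lambda> * (s * m) - \<mu> * (s - r 0)) / \<theta>)"
proof -
  have "downflow r = upflow r"
    using assms(3) by (rule ext)
  then have "downflow r sums (\<Lambda> * (s * m))"
    using upflow_sums[OF assms(1,2)] by simp
  moreover have "(\<lambda>n. \<mu> * r (Suc n)) sums (\<mu> * (s - r 0))"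
    using assms(2) by (intro sums_mult) (simp add: sums_Suc_iff)
  ultimately have "(\<lambda>n. (downflow r n - \<mu> * r (Suc n)) / \<theta>) sums ((\<Lambda> * (s * m) - \<mu> * (s - r 0)) / \<theta>)"
    by (intro sums_divide sums_diff)
  moreover have "(\<lambda>n. (downflow r n - \<mu> * r (Suc n)) / \<theta>) = (\<lambda>n. real (Suc n) * r (Suc n))"
    using rates_pos by (intro ext) (simp add: downflow_def field_simps)
  ultimately have "(\<lambda>n. real (Suc n) * r (Suc n)) sums ((\<Lambda> * (s * m) - \<mu> * (s - r 0)) / \<theta>)"
    by (simp only:)
  from sums_Suc[of "\<lambda>n. real n * r n", OF this] show ?thesis
    by simp
qed

lemma exists_cut_balanced_pmf:
  obtains \<pi> where "\<And>n. downflow (pmf \<pi>) n = upflow (pmf \<pi>) n"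
proof -
  define S where "S = suminf weight"
  have "(\<Sum>n\<in>{0}. weight n) \<le> S"
    unfolding S_def using summable_weight weight_nonneg by (intro sum_le_suminf) auto
  then have S_pos: "0 < S"
    by simp
  have "(\<lambda>n. weight n / S) sums 1"
    using sums_divide[OF summable_sums[OF summable_weight], of S] S_pos by (simp add: S_def)
  then have "(\<integral>\<^sup>+ n. ennreal (weight n / S) \<partial>count_space UNIV) = 1"
    using S_pos weight_nonneg
    by (simp add: nn_integral_count_space_nat suminf_ennreal2 sums_iff)
  then have pmf: "pmf (embed_pmf (\<lambda>n. weight n / S)) = (\<lambda>n. weight n / S)"
    using S_pos weight_nonneg by (intro ext pmf_embed_pmf) auto
  show thesis
  proof (rule that)
    fix n
    have "downflow (\<lambda>n. weight n / S) n = downflow weight n / S"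
      by (simp add: downflow_def)
    also have "\<dots> = upflow (\<lambda>n. weight n / S) n"
      by (simp add: weight_cut_balance upflow_def flip: sum_divide_distrib)
    finally show "downflow (pmf (embed_pmf (\<lambda>n. weight n / S))) n
        = upflow (pmf (embed_pmf (\<lambda>n. weight n / S))) n"
      by (simp only: pmf)
  qed
qed

lemma cut_balanced_pmf_unique:
  assumes "\<And>n. downflow (pmf \<pi>) n = upflow (pmf \<pi>) n" "\<And>n. downflow (pmf \<pi>') n = upflow (pmf \<pi>') n"
  shows "\<pi> = \<pi>'"
proof (rule pmf_eqI)
  have total: "pmf \<pi> 0 * suminf weight = 1" if "\<And>n. downflow (pmf \<pi>) n = upflow (pmf \<pi>) n" for \<pi>
  proof -
    have "pmf \<pi> = (\<lambda>n. pmf \<pi> 0 * weight n)"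
      using cut_balance_imp_eq_weight[OF that] by (rule ext)
    moreover have "(\<lambda>n. pmf \<pi> 0 * weight n) sums (pmf \<pi> 0 * suminf weight)"
      by (intro sums_mult summable_sums summable_weight)
    ultimately show ?thesis
      using sums_pmf_nat[of \<pi>] by (metis sums_unique2)
  qed
  have "pmf \<pi> 0 = pmf \<pi>' 0"
    using total[OF assms(1)] total[OF assms(2)] by (metis mult_cancel_right mult_zero_right zero_neq_one)
  then show "pmf \<pi> n = pmf \<pi>' n" for n
    using cut_balance_imp_eq_weight[OF assms(1), of n] cut_balance_imp_eq_weight[OF assms(2), of n]
    by simp
qed

subsection \<open>Generating function\<close>

text \<open>Power series of the function \<open>H\<close>, meaningful also at 1, where the quotient
  defining \<open>H\<close> reads \<open>0 / 0\<close>.\<close>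

definition tail_gf :: "real \<Rightarrow> real" where
  "tail_gf z = (\<Sum>n. tail n * z ^ n)"

lemma summable_abs_tail: "summable (\<lambda>n. \<bar>tail n\<bar>)"
  using tail_sums tail_nonneg by (simp add: sums_iff)

lemma tail_gf_nonneg: "0 \<le> z \<Longrightarrow> z \<le> 1 \<Longrightarrow> 0 \<le> tail_gf z"
  unfolding tail_gf_def
  by (intro suminf_nonneg summable_powser_unit summable_abs_tail mult_nonneg_nonneg tail_nonneg) auto

text \<open>Multiplication by \<open>1 - z\<close> telescopes the series, since consecutive tails
  differ by a value of \<open>p\<close>.\<close>

lemma tail_gf_eq:
  assumes "0 \<le> z" "z < 1"
  shows "tail_gf z = (1 - (\<Sum>n. p n * z ^ n)) / (1 - z)"
proof -
  have T: "(\<lambda>n. tail n * z ^ n) sums tail_gf z"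
    unfolding tail_gf_def
    using assms by (intro summable_sums summable_powser_unit summable_abs_tail) auto
  have "summable (\<lambda>n. p n * z ^ n)"
    using assms p_sums p_nonneg by (intro summable_powser_unit) (auto simp: sums_iff)
  then have "(\<lambda>n. p (Suc n) * z ^ Suc n) sums (\<Sum>n. p n * z ^ n)"
    using sums_Suc_iff[of "\<lambda>n. p n * z ^ n"] by (simp add: p_0 summable_sums)
  moreover have "(\<lambda>n. tail (Suc n) * z ^ Suc n) sums (tail_gf z - 1)"
    using T sums_Suc_iff[of "\<lambda>n. tail n * z ^ n"] by simp
  ultimately have "(\<lambda>n. tail (Suc n) * z ^ Suc n + p (Suc n) * z ^ Suc n)
      sums (tail_gf z - 1 + (\<Sum>n. p n * z ^ n))"
    by (intro sums_add)
  moreover have "(\<lambda>n. tail (Suc n) * z ^ Suc n + p (Suc n) * z ^ Suc n) = (\<lambda>n. z * (tail n * z ^ n))"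
    by (simp add: tail_Suc algebra_simps)
  ultimately have "z * tail_gf z = tail_gf z - 1 + (\<Sum>n. p n * z ^ n)"
    using sums_mult[OF T, of z] sums_unique2 by metis
  then show ?thesis
    using assms by (simp add: field_simps)
qed

text \<open>The term \<open>n = 0\<close> vanishes because of \<open>x / 0 = 0\<close>.\<close>

definition tail_gf_int :: "real \<Rightarrow> real" where
  "tail_gf_int z = (\<Sum>n. tail (n - 1) / real n * z ^ n)"

lemma summable_tail_gf_int: "summable (\<lambda>n. \<bar>tail (n - 1) / real n\<bar>)"
proof (subst summable_Suc_iff[symmetric])
  show "summable (\<lambda>n. \<bar>tail (Suc n - 1) / real (Suc n)\<bar>)"
    using tail_nonneg
    by (intro summable_comparison_test'[OF summable_abs_tail, of 0])
       (auto simp: divide_le_eq mult_left_le_one_le algebra_simps)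
qed

lemma tail_gf_int_deriv:
  assumes "\<bar>z\<bar> < 1"
  shows "(tail_gf_int has_real_derivative tail_gf z) (at z)"
proof -
  have "diffs (\<lambda>n. tail (n - 1) / real n) = tail"
    by (simp add: diffs_def fun_eq_iff del: of_nat_Suc)
  moreover have "((\<lambda>z. \<Sum>n. tail (n - 1) / real n * z ^ n) has_real_derivative
      (\<Sum>n. diffs (\<lambda>n. tail (n - 1) / real n) n * z ^ n)) (at z)"
    using assms summable_rabs_cancel[OF summable_tail_gf_int] by (intro termdiffs_strong[where K=1]) auto
  ultimately show ?thesis
    by (simp add: tail_gf_int_def[abs_def] tail_gf_def)
qed

lemma continuous_on_tail_gf_int: "continuous_on {0..1} tail_gf_int"
  unfolding tail_gf_int_def[abs_def]
  by (intro continuous_on_powser_unit_interval summable_tail_gf_int)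

lemma isCont_tail_gf: "\<bar>z\<bar> < 1 \<Longrightarrow> isCont tail_gf z"
  unfolding tail_gf_def[abs_def]
  using summable_rabs_cancel[OF summable_abs_tail] by (intro isCont_powser[where K=1]) auto

lemma integral_tail_gf:
  assumes "0 < v" "v < 1"
  shows "(LBINT u=v..1. tail_gf u) = tail_gf_int 1 - tail_gf_int v"
  unfolding one_ereal_def
proof (rule interval_integral_FTC_nonneg)
  have "continuous_on {v..1} tail_gf_int"
    by (rule continuous_on_subset[OF continuous_on_tail_gf_int]) (use assms in auto)
  then show "((tail_gf_int \<circ> real_of_ereal) \<longlongrightarrow> tail_gf_int v) (at_right (ereal v))"
    and "((tail_gf_int \<circ> real_of_ereal) \<longlongrightarrow> tail_gf_int 1) (at_left (ereal 1))"
    using assms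
    by (auto simp: ereal_tendsto_simps dest: continuous_on_Icc_at_rightD continuous_on_Icc_at_leftD)
qed (use assms in \<open>auto intro!: tail_gf_int_deriv isCont_tail_gf tail_gf_nonneg\<close>)

text \<open>The cut equation at \<open>n\<close> is multiplied by \<open>z ^ n\<close> and summed:
  the upflow becomes the Cauchy product of \<open>\<phi>\<close> and \<open>tail_gf\<close>, the
  downflow becomes \<open>\<mu> * (\<phi> z - r 0) / z\<close> plus \<open>\<theta>\<close> times
  the derivative.\<close>

lemma cut_balance_gf_deriv:
  assumes r: "\<And>n. 0 \<le> r n" "r sums s" "\<And>n. downflow r n = upflow r n" and z: "0 < z" "z < 1"
  defines "\<phi> \<equiv> (\<lambda>z. \<Sum>n. r n * z ^ n)"
  shows "(\<phi> has_real_derivative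
    (\<Lambda> / \<theta> * tail_gf z * \<phi> z - \<mu> / \<theta> * (\<phi> z - r 0) / z)) (at z)"
proof -
  have r_summable: "summable (\<lambda>n. \<bar>r n\<bar>)"
    using r by (simp add: sums_iff)
  have \<phi>_sums: "(\<lambda>n. r n * z ^ n) sums \<phi> z"
    unfolding \<phi>_def using z by (intro summable_sums summable_powser_unit r_summable) auto
  have deriv: "(\<phi> has_real_derivative (\<Sum>n. diffs r n * z ^ n)) (at z)"
    unfolding \<phi>_def using z summable_rabs_cancel[OF r_summable]
    by (intro termdiffs_strong[where K=1]) auto
  have "summable (\<lambda>n. diffs r n * z ^ n)"
    using z summable_powser_unit[OF r_summable] by (intro termdiff_converges[where K=1]) auto
  then have diffs_sums: "(\<lambda>n. diffs r n * z ^ n) sums (\<Sum>n. diffs r n * z ^ n)"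
    by (rule summable_sums)
  have "(\<lambda>n. r (Suc n) * z ^ Suc n) sums (\<phi> z - r 0)"
    using \<phi>_sums sums_Suc_iff[of "\<lambda>n. r n * z ^ n"] by simp
  then have "(\<lambda>n. r (Suc n) * z ^ Suc n / z) sums ((\<phi> z - r 0) / z)"
    by (rule sums_divide)
  with diffs_sums have lhs: "(\<lambda>n. \<mu> * (r (Suc n) * z ^ Suc n / z) + \<theta> * (diffs r n * z ^ n))
      sums (\<mu> * ((\<phi> z - r 0) / z) + \<theta> * (\<Sum>n. diffs r n * z ^ n))"
    by (intro sums_add sums_mult)
  have terms: "\<mu> * (r (Suc n) * z ^ Suc n / z) + \<theta> * (diffs r n * z ^ n)
      = \<Lambda> * (\<Sum>j\<le>n. (r j * z ^ j) * (tail (n - j) * z ^ (n - j)))" for n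
  proof -
    have "\<mu> * (r (Suc n) * z ^ Suc n / z) + \<theta> * (diffs r n * z ^ n) = downflow r n * z ^ n"
      using z by (simp add: downflow_def diffs_def algebra_simps)
    also have "\<dots> = \<Lambda> * (\<Sum>j\<le>n. r j * tail (n - j) * z ^ n)"
      by (simp add: r(3) upflow_def sum_distrib_right)
    also have "(\<Sum>j\<le>n. r j * tail (n - j) * z ^ n) = (\<Sum>j\<le>n. (r j * z ^ j) * (tail (n - j) * z ^ (n - j)))"
      by (intro sum.cong) (auto simp: power_add[symmetric])
    finally show ?thesis .
  qed
  have "(\<lambda>n. \<Sum>j\<le>n. (r j * z ^ j) * (tail (n - j) * z ^ (n - j)))
      sums (\<phi> z * tail_gf z)"
    unfolding \<phi>_def tail_gf_def
    using z r(1) tail_nonneg summable_powser_unit[OF r_summable, of z]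
      summable_powser_unit[OF summable_abs_tail, of z]
    by (intro Cauchy_product_sums) (simp_all add: abs_mult)
  then have "(\<lambda>n. \<mu> * (r (Suc n) * z ^ Suc n / z) + \<theta> * (diffs r n * z ^ n))
      sums (\<Lambda> * (\<phi> z * tail_gf z))"
    unfolding terms by (rule sums_mult)
  with lhs have "\<mu> * ((\<phi> z - r 0) / z) + \<theta> * (\<Sum>n. diffs r n * z ^ n) = \<Lambda> * (\<phi> z * tail_gf z)"
    by (rule sums_unique2)
  then have "(\<Sum>n. diffs r n * z ^ n) = (\<Lambda> * (\<phi> z * tail_gf z) - \<mu> * ((\<phi> z - r 0) / z)) / \<theta>"
    using rates_pos by (simp add: eq_divide_eq mult.commute)
  also have "\<dots> = \<Lambda> / \<theta> * tail_gf z * \<phi> z - \<mu> / \<theta> * (\<phi> z - r 0) / z"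
    by (simp add: diff_divide_distrib right_diff_distrib mult_ac)
  finally have "(\<Sum>n. diffs r n * z ^ n) = \<Lambda> / \<theta> * tail_gf z * \<phi> z - \<mu> / \<theta> * (\<phi> z - r 0) / z" .
  with deriv show ?thesis by simp
qed

text \<open>The integrating factor \<open>z\<^sup>\<delta> exp(\<nu> \<integral>\<^sub>z\<^sup>1 H)\<close> turns the equation for \<open>\<phi>'\<close> into
  \<open>F' = \<delta> r\<^sub>0 z\<^sup>\<delta>\<^sup>-\<^sup>1 exp(\<nu> \<integral>\<^sub>z\<^sup>1 H)\<close> with \<open>F(0) = 0\<close> and \<open>F(1) = \<phi>(1) = 1\<close>.\<close>

lemma cut_balance_normalisation:
  assumes r: "\<And>n. 0 \<le> r n" "r sums 1" "\<And>n. downflow r n = upflow r n"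
  shows "\<mu> / \<theta> * r 0 * (LBINT v=0..1. v powr (\<mu> / \<theta> - 1) *
    exp (\<Lambda> / \<theta> * (LBINT u=v..1. tail_gf u))) = 1"
proof -
  define \<phi> where "\<phi> = (\<lambda>z. \<Sum>n. r n * z ^ n)"
  define E where "E z = exp (\<Lambda> / \<theta> * (tail_gf_int 1 - tail_gf_int z))" for z
  define F where "F z = z powr (\<mu> / \<theta>) * E z * \<phi> z" for z
  define f where "f z = \<mu> / \<theta> * r 0 * (z powr (\<mu> / \<theta> - 1) * E z)" for z
  have E_deriv: "(E has_real_derivative - (\<Lambda> / \<theta> * tail_gf z) * E z) (at z)" if "0 < z" "z < 1" for z
    unfolding E_def[abs_def] using that rates_pos
    by (auto intro!: derivative_eq_intros tail_gf_int_deriv)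
  have F_deriv: "(F has_real_derivative f z) (at z)" if "0 < z" "z < 1" for z
  proof -
    have "((\<lambda>z. z powr (\<mu> / \<theta>)) has_real_derivative \<mu> / \<theta> * z powr (\<mu> / \<theta> - 1)) (at z)"
      using that by (auto intro!: derivative_eq_intros)
    moreover have "(\<phi> has_real_derivative
        (\<Lambda> / \<theta> * tail_gf z * \<phi> z - \<mu> / \<theta> * (\<phi> z - r 0) / z)) (at z)"
      unfolding \<phi>_def using that by (rule cut_balance_gf_deriv[OF r])
    ultimately have "(F has_real_derivative
        (\<mu> / \<theta> * z powr (\<mu> / \<theta> - 1) * E z + (- (\<Lambda> / \<theta> * tail_gf z) * E z) * z powr (\<mu> / \<theta>)) * \<phi> z
        + (\<Lambda> / \<theta> * tail_gf z * \<phi> z - \<mu> / \<theta> * (\<phi> z - r 0) / z) * (z powr (\<mu> / \<theta>) * E z)) (at z)"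
      unfolding F_def[abs_def] by (intro DERIV_mult E_deriv that)
    \<comment> \<open>The extracted factor \<open>z\<close> absorbs the \<open>1 / z\<close> in the
      equation for \<open>\<phi>\<close>; all terms with \<open>\<phi>\<close> then cancel and only
      \<open>r 0\<close> survives.\<close>
    moreover have "z powr (\<mu> / \<theta>) = z * z powr (\<mu> / \<theta> - 1)"
      using that by (simp add: powr_diff)
    ultimately show ?thesis
      unfolding f_def using that by (simp add: algebra_simps diff_divide_distrib)
  qed
  have F_cont: "continuous_on {0..1} F"
    unfolding F_def[abs_def] E_def \<phi>_def
    using r rates_pos
    by (intro continuous_intros continuous_on_powr' continuous_on_tail_gf_int
          continuous_on_powser_unit_interval) (auto simp: sums_iff)
  \<comment> \<open>When \<open>\<mu> < \<theta>\<close>, \<open>f\<close> may be unbounded near 0;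
    the version for nonnegative integrands needs only one-sided limits of \<open>F\<close> at the
    ends.\<close>
  have "(LBINT z=ereal 0..ereal 1. f z) = F 1 - F 0"
  proof (rule interval_integral_FTC_nonneg)
    show "((F \<circ> real_of_ereal) \<longlongrightarrow> F 0) (at_right (ereal 0))"
      and "((F \<circ> real_of_ereal) \<longlongrightarrow> F 1) (at_left (ereal 1))"
      using F_cont
      by (auto simp: ereal_tendsto_simps dest: continuous_on_Icc_at_rightD continuous_on_Icc_at_leftD)
    show "isCont f z" if "ereal 0 < ereal z" "ereal z < ereal 1" for z
      unfolding f_def[abs_def] using that
      by (intro continuous_intros DERIV_isCont[OF E_deriv]) auto
    show "AE z in lborel. ereal 0 < ereal z \<longrightarrow> ereal z < ereal 1 \<longrightarrow> 0 \<le> f z"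
      using r(1) rates_pos by (auto simp: f_def E_def)
  qed (auto intro: F_deriv)
  also have "F 0 = 0"
    using rates_pos by (simp add: F_def)
  also have "F 1 = 1"
    using r(2) by (simp add: F_def E_def \<phi>_def sums_iff)
  also have "(LBINT z=ereal 0..ereal 1. f z) = (LBINT z=0..1. \<mu> / \<theta> * r 0 * (z powr (\<mu> / \<theta> - 1) *
    exp (\<Lambda> / \<theta> * (LBINT u=z..1. tail_gf u))))"
    unfolding zero_ereal_def one_ereal_def
    by (intro interval_integral_cong)
       (auto simp: f_def E_def einterval_def integral_tail_gf[unfolded one_ereal_def])
  finally show ?thesis
    by simp
qed

end

section \<open>The order book\<close>

lemma batch_queue_book:
  assumes "\<mu> > 0" "\<theta> > 0" "cum_rate lam k > 0"
    and lam: "\<And>i. i \<in> {1..k} \<Longrightarrow> lam i \<ge> 0"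
    and size_0: "\<And>i. i \<in> {1..k} \<Longrightarrow> pmf (g i) 0 = 0"
    and mean: "\<And>i. i \<in> {1..k} \<Longrightarrow> summable (\<lambda>n. real n * pmf (g i) n)"
  shows "batch_queue \<mu> \<theta> (cum_rate lam k) (cum_mean_size lam g k) (cum_size_prob lam g k)"
proof
  show "0 \<le> cum_size_prob lam g k n" for n
    unfolding cum_size_prob_def using assms(3) lam
    by (intro sum_nonneg mult_nonneg_nonneg divide_nonneg_pos) auto
  show "cum_size_prob lam g k 0 = 0"
    by (simp add: cum_size_prob_def size_0)
  have "cum_size_prob lam g k sums (\<Sum>i=1..k. lam i / cum_rate lam k * 1)"
    unfolding cum_size_prob_def[abs_def] by (intro sums_sum sums_mult sums_pmf_nat)
  also have "(\<Sum>i=1..k. lam i / cum_rate lam k * 1) = 1"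
    using assms(3) by (simp add: sum_divide_distrib[symmetric] cum_rate_def)
  finally show "cum_size_prob lam g k sums 1" .
  have "(\<lambda>n. \<Sum>i=1..k. lam i / cum_rate lam k * (real n * pmf (g i) n)) sums cum_mean_size lam g k"
    unfolding cum_mean_size_def mean_size_def
    by (intro sums_sum sums_mult summable_sums mean) auto
  then show "(\<lambda>n. real n * cum_size_prob lam g k n) sums cum_mean_size lam g k"
    by (simp add: cum_size_prob_def sum_distrib_left mult_ac)
qed (use assms in auto)

lemma book_rates_has_sum_exit_rate:
  assumes "batch_queue \<mu> \<theta> (cum_rate lam k) m (cum_size_prob lam g k)"
  shows "(book_rates \<mu> \<theta> lam g k n has_sum batch_queue.exit_rate \<mu> \<theta> (cum_rate lam k) n) (- {n})"
proof -
  interpret batch_queue \<mu> \<theta> "cum_rate lam k" m "cum_size_prob lam g k"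
    by fact
  let ?q = "book_rates \<mu> \<theta> lam g k n"
  have "(\<lambda>i. cum_size_prob lam g k (Suc i)) sums 1"
    using p_sums p_0 by (simp add: sums_Suc_iff)
  then have "(\<lambda>i. cum_rate lam k * cum_size_prob lam g k (Suc i)) sums (cum_rate lam k * 1)"
    by (rule sums_mult)
  moreover have "(\<lambda>i. cum_rate lam k * cum_size_prob lam g k (Suc i)) = (\<lambda>i. ?q (i + Suc n))"
    by (simp add: book_rates_def)
  \<comment> \<open>The head of the series holds only the departure to \<open>n - 1\<close>, absent
    for \<open>n = 0\<close>; the diagonal rate is 0.\<close>
  moreover have "(\<Sum>i<Suc n. ?q i) = exit_rate n - cum_rate lam k"
    by (cases n) (auto simp: book_rates_def exit_rate_def)
  ultimately have "?q sums exit_rate n"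
    using sums_iff_shift[of ?q "Suc n" "cum_rate lam k"] by simp
  moreover have "0 \<le> ?q i" for i
    using rates_pos p_nonneg by (simp add: book_rates_def)
  ultimately have "(?q has_sum exit_rate n) UNIV"
    by (intro sums_nonneg_imp_has_sum)
  then show ?thesis
    by (rule has_sum_cong_neutral[THEN iffD1, rotated -1]) (auto simp: book_rates_def)
qed

text \<open>Departures have size 1, so each state has finitely many sources: the states below it and
  \<open>Suc y\<close>. This makes the truncated flow inequalities as strong as the full
  ones.\<close>

lemma book_rates_inflow:
  assumes "batch_queue \<mu> \<theta> (cum_rate lam k) m (cum_size_prob lam g k)"
  shows "(\<Sum>x\<in>insert (Suc y) {..<y}. r x * book_rates \<mu> \<theta> lam g k x y)
    = (\<Sum>x<y. r x * (cum_rate lam k * cum_size_prob lam g k (y - x))) + batch_queue.downflow \<mu> \<theta> r y"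
  by (simp add: batch_queue.downflow_def[OF assms] book_rates_def)

text \<open>For any chain with these rates, existence and uniqueness of the stationary law reduce to
  the cut recursion.\<close>

lemma stationary_iff_cut_balance:
  assumes queue: "batch_queue \<mu> \<theta> (cum_rate lam k) m (cum_size_prob lam g k)"
    and mc: "markov_chain_with_rates P (book_rates \<mu> \<theta> lam g k)"
  shows "stationary_distribution P \<pi> \<longleftrightarrow> (\<forall>n. batch_queue.downflow \<mu> \<theta> (pmf \<pi>) n
    = batch_queue.upflow (cum_rate lam k) (cum_size_prob lam g k) (pmf \<pi>) n)"
proof -
  interpret batch_queue \<mu> \<theta> "cum_rate lam k" m "cum_size_prob lam g k"
    by fact
  note exit = book_rates_has_sum_exit_rate[OF queue]
  note inflow = book_rates_inflow[OF queue]
  show ?thesis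
  proof (intro iffI allI)
    fix n assume stat: "stationary_distribution P \<pi>"
    have sub: "(\<Sum>x<y. pmf \<pi> x * (cum_rate lam k * cum_size_prob lam g k (y - x))) + downflow (pmf \<pi>) y
        \<le> exit_rate y * pmf \<pi> y" for y
      using stationary_imp_subinvariant[OF mc stat exit, of "insert (Suc y) {..<y}" y]
      by (simp only: inflow mult.commute) simp
    show "downflow (pmf \<pi>) n = upflow (pmf \<pi>) n"
      by (rule subinvariant_imp_cut_balance[OF pmf_nonneg sums_summable[OF sums_pmf_nat] _ sub])
         (use sub[of 0] in simp)
  next
    assume balanced: "\<forall>n. downflow (pmf \<pi>) n = upflow (pmf \<pi>) n"
    note balance = cut_balance_imp_balance[OF balanced[rule_format]]
    show "stationary_distribution P \<pi>"
    proof (rule invariant_imp_stationary[OF mc exit])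
      show "pmf \<pi> y * exit_rate y
          = (\<Sum>x\<in>insert (Suc y) {..<y}. pmf \<pi> x * book_rates \<mu> \<theta> lam g k x y)" for y
        unfolding inflow using balance(1) balance(2)[of "y - 1"] by (cases y) (simp_all add: mult.commute)
      have "integrable (measure_pmf \<pi>) real"
        using cut_balance_mean_sums[OF _ sums_pmf_nat balanced[rule_format]]
        by (intro expectation_nat_pmf) auto
      then have "integrable (measure_pmf \<pi>) (\<lambda>n. cum_rate lam k + \<mu> + real n * \<theta>)"
        by auto
      then show "integrable (measure_pmf \<pi>) exit_rate"
        by (rule Bochner_Integration.integrable_bound)
           (use rates_pos in \<open>auto simp: exit_rate_def\<close>)
    qed auto
  qed
qed

theorem proposition3:
  fixes \<mu> \<theta> :: real and lam :: "nat \<Rightarrow> real" and g :: "nat \<Rightarrow> nat pmf" and K k :: nat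
    and P :: "real \<Rightarrow> nat \<Rightarrow> nat pmf"
  assumes "\<mu> > 0" and "\<theta> > 0"
    and "\<And>i. i \<in> {1..K} \<Longrightarrow> lam i \<ge> 0"
    and "\<And>i. i \<in> {1..K} \<Longrightarrow> pmf (g i) 0 = 0"
    and "\<And>i. i \<in> {1..K} \<Longrightarrow> summable (\<lambda>n. real n * pmf (g i) n)"
    and "k \<in> {1..K}" and "cum_rate lam k > 0"
    and "markov_chain_with_rates P (book_rates \<mu> \<theta> lam g k)"
  shows "(\<exists>!\<pi>. stationary_distribution P \<pi>) \<and>
    (\<forall>\<pi>. stationary_distribution P \<pi> \<longrightarrow>
       integrable (measure_pmf \<pi>) real \<and>
       measure_pmf.expectation \<pi> real =
         cum_rate lam k / \<theta> * cum_mean_size lam g k - \<mu> / \<theta> +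
         inverse (LBINT v=0..1. v powr (\<mu> / \<theta> - 1) *
           exp (cum_rate lam k / \<theta> * (LBINT u=v..1. cum_size_H lam g k u))))"
proof -
  have queue: "batch_queue \<mu> \<theta> (cum_rate lam k) (cum_mean_size lam g k) (cum_size_prob lam g k)"
    using assms by (intro batch_queue_book) auto
  interpret batch_queue \<mu> \<theta> "cum_rate lam k" "cum_mean_size lam g k" "cum_size_prob lam g k"
    by (fact queue)
  note stationary_iff = stationary_iff_cut_balance[OF queue assms(8)]
  have "\<exists>!\<pi>. stationary_distribution P \<pi>"
    unfolding stationary_iff using exists_cut_balanced_pmf cut_balanced_pmf_unique by metis
  moreover have "integrable (measure_pmf \<pi>) real \<and> measure_pmf.expectation \<pi> real =
      cum_rate lam k / \<theta> * cum_mean_size lam g k - \<mu> / \<theta> +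
      inverse (LBINT v=0..1. v powr (\<mu> / \<theta> - 1) *
        exp (cum_rate lam k / \<theta> * (LBINT u=v..1. cum_size_H lam g k u)))" (is "_ \<and> _ = _ + inverse ?I")
    if "stationary_distribution P \<pi>" for \<pi>
  proof -
    have balanced: "\<And>n. downflow (pmf \<pi>) n = upflow (pmf \<pi>) n"
      using that by (simp add: stationary_iff)
    \<comment> \<open>The open interval suffices: at 1 the quotient has the default value 0, but
      interval integrals ignore the endpoints.\<close>
    have H_eq: "cum_size_H lam g k u = tail_gf u" if "0 < u" "u < 1" for u
      using that by (simp add: cum_size_H_def cum_size_gf_def tail_gf_eq)
    have "(LBINT u=v..1. cum_size_H lam g k u) = (LBINT u=v..1. tail_gf u)"
      if "0 < v" "v < 1" for v :: real
      using that unfolding one_ereal_def by (intro interval_integral_cong) (auto simp: einterval_def H_eq)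
    then have I_eq: "?I = (LBINT v=0..1. v powr (\<mu> / \<theta> - 1) *
        exp (cum_rate lam k / \<theta> * (LBINT u=v..1. tail_gf u)))"
      unfolding zero_ereal_def one_ereal_def by (intro interval_integral_cong) (auto simp: einterval_def)
    \<comment> \<open>This also excludes \<open>?I = 0\<close>, where \<open>inverse\<close> takes a
      default value.\<close>
    have "?I * (\<mu> / \<theta> * pmf \<pi> 0) = 1"
      unfolding I_eq
      by (subst mult.commute) (intro cut_balance_normalisation sums_pmf_nat balanced pmf_nonneg)
    then have "inverse ?I = \<mu> / \<theta> * pmf \<pi> 0"
      by (rule inverse_unique)
    moreover have "(cum_rate lam k * (1 * cum_mean_size lam g k) - \<mu> * (1 - pmf \<pi> 0)) / \<theta>
        = cum_rate lam k / \<theta> * cum_mean_size lam g k - \<mu> / \<theta> + \<mu> / \<theta> * pmf \<pi> 0"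
      by (simp add: diff_divide_distrib add_divide_distrib right_diff_distrib)
    ultimately show ?thesis
      using expectation_nat_pmf[OF cut_balance_mean_sums[OF _ sums_pmf_nat balanced]] by simp
  qed
  ultimately show ?thesis
    by blast
qed

end
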